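(* Let $\Bbbk$ be a field, let $p,\alpha\in\Bbbk$ with $p\neq 0,\pm1$ and $\alpha\neq0$, and let $\mathbb{G}$ be the $\Bbbk$-algebra generated by $y_1,y_2,x_1,x_2$ subject to the relations $$x_2x_1=x_1x_2,\quad y_2y_1=p\,y_1y_2,\quad y_1x_1=p\,x_1y_1,\quad y_2x_1=p\,x_1y_2,$$ $$y_1x_2=p\,x_1y_1+p^2x_2y_1+x_1y_2,\quad y_2x_2=\alpha x_1y_1-x_1y_2+x_2y_2.$$ Let $S\subset\Bbbk\{y_1,y_2,x_1,x_2\}$ be the set consisting of the six polynomials $$x_2x_1-x_1x_2,\quad y_2y_1-p\,y_1y_2,\quad x_1y_1-\tfrac1p y_1x_1,\quad x_1y_2-\tfrac1p y_2x_1,$$ $$x_2y_1-\tfrac1{p^2}y_1x_2+\tfrac1{p^2}y_1x_1+\tfrac1{p^3}y_2x_1,\quad x_2y_2+\tfrac{\alpha}{p}y_1x_1-\tfrac1p y_2x_1-y_2x_2.$$ Then, with respect to the degree lexicographic order with $y_1\prec y_2\prec x_1\prec x_2$, the set $S$ is a Gröbner-Shirshov basis of the ideal $\mathrm{Id}(S)$, which is the ideal of defining relations of $\mathbb{G}$, i.e. $\mathbb{G}=\Bbbk\{y_1,y_2,x_1,x_2\}/\mathrm{Id}(S)$.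
   Context: Let $X=\{y_1,y_2,x_1,x_2\}$, let $X^*$ be the free monoid of words in $X$, and let $\Bbbk\{X\}$ be the free associative unital $\Bbbk$-algebra on $X$ (noncommutative polynomials). $\mathrm{Id}(S)$ denotes the two-sided ideal of $\Bbbk\{X\}$ generated by $S$. The degree lexicographic order $\prec$ on $X^*$ compares words first by length and then, for equal length, lexicographically from left to right with $y_1\prec y_2\prec x_1\prec x_2$. For a nonzero $f\in\Bbbk\{X\}$, $\overline{f}$ denotes its leading (i.e. $\prec$-largest) word; $f$ is monic if the coefficient of $\overline{f}$ is $1$. For monic $f,g$: (i) if $w=\overline{f}a=b\overline{g}$ with $a,b\in X^*$ and $|\overline{f}|+|\overline{g}|>|w|$, then $(f,g)_w:=fa-bg$ is the intersection composition; (ii) if $w=\overline{f}=a\overline{g}b$ with $a,b\in X^*$, then $(f,g)_w:=f-agb$ is the inclusion composition. A composition $(f,g)_w$ is trivial modulo $S$ if $(f,g)_w=\sum_i\alpha_i a_is_ib_i$ (finite sum) with $\alpha_i\in\Bbbk$, $a_i,b_i\in X^*$, $s_i\in S$ and $a_i\overline{s_i}b_i\prec w$ for all $i$. A nonempty set $S$ of monic polynomials is a Gröbner-Shirshov basis of $\mathrm{Id}(S)$ if every composition $(f,g)_w$ with $f,g\in S$ is trivial modulo $S$. *)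

theory Defs
  imports "HOL-Library.Poly_Mapping" "HOL-Algebra.QuotRing" "HOL-Algebra.Module"
begin

section \<open>The free associative algebra\<close>

text \<open>Poly_Mapping writes the monoid of exponents additively. Hence words carry an additive
  monoid structure, and \<open>+\<close> on words is concatenation. Multiplication on
  \<open>'x fword \<Rightarrow>\<^sub>0 'k\<close> is then the product of noncommutative polynomials.\<close>

datatype 'x fword = FWord (letters: "'x list")

instantiation fword :: (type) monoid_add
begin

definition zero_fword :: "'x fword" where
  "zero_fword = FWord []"

definition plus_fword :: "'x fword \<Rightarrow> 'x fword \<Rightarrow> 'x fword" where
  "plus_fword u v = FWord (letters u @ letters v)"

instance
  by standard (simp_all add: zero_fword_def plus_fword_def)

end

definition fword_length :: "'x fword \<Rightarrow> nat" where
  "fword_length u = length (letters u)"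

type_synonym ('x, 'k) ncpoly = "'x fword \<Rightarrow>\<^sub>0 'k"

definition of_word :: "'x fword \<Rightarrow> ('x, 'k::field) ncpoly" where
  "of_word u = Poly_Mapping.single u 1"

definition scal :: "'k \<Rightarrow> ('x, 'k::field) ncpoly \<Rightarrow> ('x, 'k) ncpoly"  (infixr \<open>\<cdot>\<^sub>k\<close> 75) where
  "c \<cdot>\<^sub>k f = Poly_Mapping.map (\<lambda>d. c * d) f"

definition free_algebra :: "('k::field, ('x, 'k) ncpoly) module" where
  "free_algebra =
    \<lparr>carrier = UNIV, mult = (*), one = 1, zero = 0, add = (+), smult = scal\<rparr>"

text \<open>The following ensures that the intersection in \<^const>\<open>genideal\<close> is not taken over
  an empty family, as \<^const>\<open>ideal\<close> includes the ring axioms.\<close>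

lemma ring_free_algebra: "ring (free_algebra :: ('k::field, ('x, 'k) ncpoly) module)"
proof (rule ringI)
  show "abelian_group (free_algebra :: ('k, ('x, 'k) ncpoly) module)"
  proof (rule abelian_groupI)
    fix f :: "('x, 'k) ncpoly"
    show "\<exists>g\<in>carrier free_algebra. g \<oplus>\<^bsub>free_algebra\<^esub> f = \<zero>\<^bsub>free_algebra\<^esub>"
      by (rule bexI[of _ "- f"]) (simp_all add: free_algebra_def)
  qed (simp_all add: free_algebra_def algebra_simps)
  show "Group.monoid (free_algebra :: ('k, ('x, 'k) ncpoly) module)"
    by (rule monoidI) (simp_all add: free_algebra_def algebra_simps)
qed (simp_all add: free_algebra_def algebra_simps)

definition ideal_gen :: "('x, 'k::field) ncpoly set \<Rightarrow> ('x, 'k) ncpoly set" where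
  "ideal_gen S = genideal free_algebra S"

text \<open>\<^const>\<open>FactRing\<close> only yields a ring; the scalar action below is
  \<open>c (I + f) = I + c f\<close>.\<close>

definition quotient_algebra :: "('k, 'a) module \<Rightarrow> 'a set \<Rightarrow> ('k, 'a set) module" where
  "quotient_algebra A I =
    ring.extend (A Quot I) (module.fields (\<lambda>c C. \<Union>f\<in>C. I +>\<^bsub>A\<^esub> (c \<odot>\<^bsub>A\<^esub> f)))"

definition presented_algebra :: "('x, 'k::field) ncpoly set \<Rightarrow> ('k, ('x, 'k) ncpoly set) module" where
  "presented_algebra R = quotient_algebra free_algebra (ideal_gen R)"

section \<open>Groebner-Shirshov bases\<close>

definition deglex :: "'x::linorder fword \<Rightarrow> 'x fword \<Rightarrow> bool"  (infix \<open>\<prec>\<close> 50) where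
  "u \<prec> v \<longleftrightarrow> (letters u, letters v) \<in> lenlex {(a, b). a < b}"

definition lead :: "('x::linorder, 'k::field) ncpoly \<Rightarrow> 'x fword" where
  "lead f = (THE w. w \<in> Poly_Mapping.keys f \<and> (\<forall>v \<in> Poly_Mapping.keys f. v \<noteq> w \<longrightarrow> v \<prec> w))"

definition is_monic :: "('x::linorder, 'k::field) ncpoly \<Rightarrow> bool" where
  "is_monic f \<longleftrightarrow> f \<noteq> 0 \<and> Poly_Mapping.lookup f (lead f) = 1"

definition is_intersection_composition ::
  "('x::linorder, 'k::field) ncpoly \<Rightarrow> ('x, 'k) ncpoly \<Rightarrow> 'x fword \<Rightarrow> ('x, 'k) ncpoly \<Rightarrow> bool" where
  "is_intersection_composition f g w h \<longleftrightarrow>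
    (\<exists>a b. w = lead f + a \<and> w = b + lead g
       \<and> fword_length (lead f) + fword_length (lead g) > fword_length w
       \<and> h = f * of_word a - of_word b * g)"

definition is_inclusion_composition ::
  "('x::linorder, 'k::field) ncpoly \<Rightarrow> ('x, 'k) ncpoly \<Rightarrow> 'x fword \<Rightarrow> ('x, 'k) ncpoly \<Rightarrow> bool" where
  "is_inclusion_composition f g w h \<longleftrightarrow>
    (\<exists>a b. w = lead f \<and> w = a + lead g + b \<and> h = f - of_word a * g * of_word b)"

definition is_composition ::
  "('x::linorder, 'k::field) ncpoly \<Rightarrow> ('x, 'k) ncpoly \<Rightarrow> 'x fword \<Rightarrow> ('x, 'k) ncpoly \<Rightarrow> bool" where
  "is_composition f g w h \<longleftrightarrow>
    is_intersection_composition f g w h \<or> is_inclusion_composition f g w h"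

definition trivial_mod ::
  "('x::linorder, 'k::field) ncpoly set \<Rightarrow> 'x fword \<Rightarrow> ('x, 'k) ncpoly \<Rightarrow> bool" where
  "trivial_mod S w h \<longleftrightarrow>
    (\<exists>(n::nat) \<alpha> a s b.
       (\<forall>i<n. s i \<in> S \<and> a i + lead (s i) + b i \<prec> w)
       \<and> h = (\<Sum>i<n. \<alpha> i \<cdot>\<^sub>k (of_word (a i) * s i * of_word (b i))))"

text \<open>Read: \<open>S\<close> is a Groebner-Shirshov basis of \<open>ideal_gen S\<close>.\<close>

definition groebner_shirshov_basis :: "('x::linorder, 'k::field) ncpoly set \<Rightarrow> bool" where
  "groebner_shirshov_basis S \<longleftrightarrow>
    S \<noteq> {} \<and> (\<forall>f\<in>S. is_monic f)
    \<and> (\<forall>f\<in>S. \<forall>g\<in>S. \<forall>w h. is_composition f g w h \<longrightarrow> trivial_mod S w h)"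

section \<open>The algebra \<open>\<GG>\<close>\<close>

datatype gen = Y1 | Y2 | X1 | X2

instantiation gen :: linorder
begin

primrec gen_rank :: "gen \<Rightarrow> nat" where
  "gen_rank Y1 = 0"
| "gen_rank Y2 = 1"
| "gen_rank X1 = 2"
| "gen_rank X2 = 3"

definition less_eq_gen :: "gen \<Rightarrow> gen \<Rightarrow> bool" where
  "less_eq_gen a b \<longleftrightarrow> gen_rank a \<le> gen_rank b"

definition less_gen :: "gen \<Rightarrow> gen \<Rightarrow> bool" where
  "less_gen a b \<longleftrightarrow> gen_rank a < gen_rank b"

instance
proof
  fix a b :: gen
  show "a \<le> b \<Longrightarrow> b \<le> a \<Longrightarrow> a = b"
    by (cases a; cases b) (simp_all add: less_eq_gen_def)
qed (auto simp: less_eq_gen_def less_gen_def)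

end

definition y\<^sub>1 :: "(gen, 'k::field) ncpoly" where "y\<^sub>1 = of_word (FWord [Y1])"
definition y\<^sub>2 :: "(gen, 'k::field) ncpoly" where "y\<^sub>2 = of_word (FWord [Y2])"
definition x\<^sub>1 :: "(gen, 'k::field) ncpoly" where "x\<^sub>1 = of_word (FWord [X1])"
definition x\<^sub>2 :: "(gen, 'k::field) ncpoly" where "x\<^sub>2 = of_word (FWord [X2])"

text \<open>A relation \<open>l = r\<close> is represented by the polynomial \<open>l - r\<close>.\<close>

definition G_relations :: "'k::field \<Rightarrow> 'k \<Rightarrow> (gen, 'k) ncpoly set" where
  "G_relations p \<alpha> =
    { x\<^sub>2 * x\<^sub>1 - x\<^sub>1 * x\<^sub>2,
      y\<^sub>2 * y\<^sub>1 - p \<cdot>\<^sub>k (y\<^sub>1 * y\<^sub>2),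
      y\<^sub>1 * x\<^sub>1 - p \<cdot>\<^sub>k (x\<^sub>1 * y\<^sub>1),
      y\<^sub>2 * x\<^sub>1 - p \<cdot>\<^sub>k (x\<^sub>1 * y\<^sub>2),
      y\<^sub>1 * x\<^sub>2 - (p \<cdot>\<^sub>k (x\<^sub>1 * y\<^sub>1) + p^2 \<cdot>\<^sub>k (x\<^sub>2 * y\<^sub>1) + x\<^sub>1 * y\<^sub>2),
      y\<^sub>2 * x\<^sub>2 - (\<alpha> \<cdot>\<^sub>k (x\<^sub>1 * y\<^sub>1) - x\<^sub>1 * y\<^sub>2 + x\<^sub>2 * y\<^sub>2) }"

definition G_algebra :: "'k::field \<Rightarrow> 'k \<Rightarrow> ('k, (gen, 'k) ncpoly set) module" where
  "G_algebra p \<alpha> = presented_algebra (G_relations p \<alpha>)"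

definition G_basis :: "'k::field \<Rightarrow> 'k \<Rightarrow> (gen, 'k) ncpoly set" where
  "G_basis p \<alpha> =
    { x\<^sub>2 * x\<^sub>1 - x\<^sub>1 * x\<^sub>2,
      y\<^sub>2 * y\<^sub>1 - p \<cdot>\<^sub>k (y\<^sub>1 * y\<^sub>2),
      x\<^sub>1 * y\<^sub>1 - (1/p) \<cdot>\<^sub>k (y\<^sub>1 * x\<^sub>1),
      x\<^sub>1 * y\<^sub>2 - (1/p) \<cdot>\<^sub>k (y\<^sub>2 * x\<^sub>1),
      x\<^sub>2 * y\<^sub>1 - (1/p^2) \<cdot>\<^sub>k (y\<^sub>1 * x\<^sub>2) + (1/p^2) \<cdot>\<^sub>k (y\<^sub>1 * x\<^sub>1) + (1/p^3) \<cdot>\<^sub>k (y\<^sub>2 * x\<^sub>1),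
      x\<^sub>2 * y\<^sub>2 + (\<alpha>/p) \<cdot>\<^sub>k (y\<^sub>1 * x\<^sub>1) - (1/p) \<cdot>\<^sub>k (y\<^sub>2 * x\<^sub>1) - y\<^sub>2 * x\<^sub>2 }"

end

theory Submission
  imports Defs
begin

text \<open>
  The leading words of the basis are \<open>x\<^sub>2x\<^sub>1\<close>, \<open>y\<^sub>2y\<^sub>1\<close>, \<open>x\<^sub>1y\<^sub>1\<close>, \<open>x\<^sub>1y\<^sub>2\<close>, \<open>x\<^sub>2y\<^sub>1\<close>,
  \<open>x\<^sub>2y\<^sub>2\<close>. They are pairwise distinct words of length two, so an inclusion, or an overlap in both
  letters, only compares a polynomial with itself and gives the composition zero. The other
  compositions come from words \<open>uvv'\<close> with \<open>uv\<close> and \<open>vv'\<close> both leading, and these are exactly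
  \<open>x\<^sub>2x\<^sub>1y\<^sub>1\<close>, \<open>x\<^sub>2x\<^sub>1y\<^sub>2\<close>, \<open>x\<^sub>1y\<^sub>2y\<^sub>1\<close> and \<open>x\<^sub>2y\<^sub>2y\<^sub>1\<close>. In each of the four cases, rewriting both sides to
  a combination of words without leading factors gives the same normal form; recording the
  rewriting steps expresses the composition explicitly as a combination of multiples of basis
  elements with smaller leading words (lemmas \<open>composition_x2_x1_y1\<close> to \<open>composition_x2_y2_y1\<close>).

  For the ideals, the four defining relations that mix an \<open>x\<close> with a \<open>y\<close> are solved for the words
  \<open>x\<^sub>iy\<^sub>j\<close>. This is a linear change of generators, invertible because \<open>p \<noteq> 0\<close>, so both
  families have the same linear span and hence generate the same ideal. The description of the algebra as a
  quotient then follows from its definition.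
\<close>

section \<open>Scalars in the free algebra\<close>

lemma scal_eq_mult: "c \<cdot>\<^sub>k f = Poly_Mapping.single 0 c * f"
  by (simp add: scal_def mult_map_scale_conv_mult)

lemma lookup_scal [simp]: "Poly_Mapping.lookup (c \<cdot>\<^sub>k f) w = c * Poly_Mapping.lookup f w"
  by (simp add: scal_def map.rep_eq when_def)

text \<open>Concatenation is not commutative, but the empty word is central in the monoid of words,
  and the coefficients commute; so scalars may be pulled out of either factor.\<close>

lemma single_zero_central:
  fixes f :: "('x, 'k::field) ncpoly"
  shows "f * Poly_Mapping.single 0 c = Poly_Mapping.single 0 c * f"
proof (induction f rule: update_induct)
  case const
  show ?case by simp
next
  case (update f a b)
  have "Poly_Mapping.update a b f = f + Poly_Mapping.single a b"
    using update.hyps(1)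
    by (intro poly_mapping_eqI)
      (auto simp: lookup_update lookup_add lookup_single when_def in_keys_iff)
  then show ?case
    using update.IH by (simp add: distrib_left distrib_right mult_single mult.commute)
qed

lemma scal_mult_left: "(c \<cdot>\<^sub>k f) * g = c \<cdot>\<^sub>k (f * g)"
  by (simp add: scal_eq_mult mult.assoc)

lemma scal_mult_right: "f * (c \<cdot>\<^sub>k g) = c \<cdot>\<^sub>k (f * g)"
  unfolding scal_eq_mult by (simp only: single_zero_central mult.assoc [symmetric])

lemma scal_add: "c \<cdot>\<^sub>k (f + g) = c \<cdot>\<^sub>k f + c \<cdot>\<^sub>k g"
  by (simp add: scal_eq_mult distrib_left)

lemma scal_diff: "c \<cdot>\<^sub>k (f - g) = c \<cdot>\<^sub>k f - c \<cdot>\<^sub>k g"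
  by (simp add: scal_eq_mult right_diff_distrib)

lemma scal_scal: "c \<cdot>\<^sub>k d \<cdot>\<^sub>k f = (c * d) \<cdot>\<^sub>k f"
  by (rule poly_mapping_eqI) (simp add: mult.assoc)

lemmas expand_products =
  scal_mult_left scal_mult_right scal_add scal_diff scal_scal
  distrib_left distrib_right left_diff_distrib right_diff_distrib mult.assoc

text \<open>All coefficients below are polynomials in \<open>\<alpha>\<close>, \<open>p\<close> and \<open>inverse p\<close>. Normalising them as such makes
  the comparison of coefficients a ring computation modulo \<open>p * inverse p = 1\<close>.\<close>

lemma inverse_normal:
  fixes p :: "'k::field"
  assumes "p \<noteq> 0"
  shows "c / p = c * inverse p" "c / (p * p) = c * (inverse p * inverse p)"
    "c / (p * (p * p)) = c * (inverse p * (inverse p * inverse p))"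
    "p^2 = p * p" "p^3 = p * (p * p)"
    "p * inverse p = 1" "p * (inverse p * c) = c" "inverse p * (p * c) = c"
  using assms by (simp_all add: divide_inverse power2_eq_square power3_eq_cube)

lemmas lookup_linear = lookup_add lookup_minus lookup_uminus lookup_scal

lemma of_word_mult: "of_word u * of_word v = of_word (u + v)"
  by (simp add: of_word_def mult_single)

lemma of_word_zero: "of_word 0 = 1"
  by (simp add: of_word_def)

section \<open>Leading words\<close>

lemma deglex_irrefl: "\<not> u \<prec> u"
  by (simp add: deglex_def lenlex_irreflexive)

lemma deglex_asym:
  assumes "u \<prec> v"
  shows "\<not> v \<prec> u"
proof -
  have "asym (lenlex {(a, b). (a::'a::linorder) < b})"
    by (intro asym_lenlex asymI) auto
  then show ?thesis using assms unfolding deglex_def by (rule asymD)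
qed

definition below :: "'x::linorder fword \<Rightarrow> ('x, 'k::field) ncpoly \<Rightarrow> bool" where
  "below w g \<longleftrightarrow> (\<forall>v \<in> Poly_Mapping.keys g. v \<prec> w)"

lemma below_of_word: "v \<prec> w \<Longrightarrow> below w (of_word v)"
  by (simp add: below_def of_word_def)

lemma below_scal: "below w g \<Longrightarrow> below w (c \<cdot>\<^sub>k g)"
  by (auto simp: below_def in_keys_iff)

lemma below_add: "below w f \<Longrightarrow> below w g \<Longrightarrow> below w (f + g)"
  unfolding below_def using Poly_Mapping.keys_add[of f g] by blast

lemma below_diff: "below w f \<Longrightarrow> below w g \<Longrightarrow> below w (f - g)"
  unfolding below_def using keys_diff[of f g] by blast

lemmas below_intros = below_of_word below_scal below_add below_diff

lemma lookup_of_word_minus: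
  assumes "below w g"
  shows "Poly_Mapping.lookup (of_word w - g) w = 1"
proof -
  have "w \<notin> Poly_Mapping.keys g"
    using assms deglex_irrefl by (auto simp: below_def)
  then show ?thesis
    by (simp add: of_word_def lookup_minus in_keys_iff)
qed

lemma lead_of_word_minus:
  assumes "below w g"
  shows "lead (of_word w - g) = w"
proof -
  have w: "w \<in> Poly_Mapping.keys (of_word w - g)"
    using lookup_of_word_minus[OF assms] by (simp add: in_keys_iff)
  have max: "v \<prec> w" if "v \<in> Poly_Mapping.keys (of_word w - g)" "v \<noteq> w" for v
  proof -
    have "v \<in> Poly_Mapping.keys g"
      using that by (simp add: in_keys_iff of_word_def lookup_minus lookup_single when_def)
    then show ?thesis using assms by (simp add: below_def)
  qed
  show ?thesis
    unfolding lead_def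
  proof (rule the_equality)
    fix u
    assume u: "u \<in> Poly_Mapping.keys (of_word w - g)
      \<and> (\<forall>v \<in> Poly_Mapping.keys (of_word w - g). v \<noteq> u \<longrightarrow> v \<prec> u)"
    then show "u = w" using w max deglex_asym by metis
  qed (use w max in blast)
qed

lemma is_monic_of_word_minus:
  assumes "below w g"
  shows "is_monic (of_word w - g)"
  unfolding is_monic_def lead_of_word_minus[OF assms]
  using lookup_of_word_minus[OF assms] by force

lemma monic_leadI:
  assumes "f = of_word w - g" and "below w g"
  shows "is_monic f \<and> lead f = w"
  using assms is_monic_of_word_minus lead_of_word_minus by blast

section \<open>Trivial compositions\<close>

lemma trivial_mod_zero: "trivial_mod S w 0"
  unfolding trivial_mod_def by (rule exI[of _ 0]) simp

lemma trivial_mod_term: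
  assumes "s \<in> S" and "a + lead s + b \<prec> w"
  shows "trivial_mod S w (c \<cdot>\<^sub>k (of_word a * s * of_word b))"
  unfolding trivial_mod_def
  by (rule exI[of _ 1], rule exI[of _ "\<lambda>_. c"], rule exI[of _ "\<lambda>_. a"],
      rule exI[of _ "\<lambda>_. s"], rule exI[of _ "\<lambda>_. b"]) (use assms in simp)

lemma trivial_mod_left:
  assumes "s \<in> S" and "a + lead s \<prec> w"
  shows "trivial_mod S w (c \<cdot>\<^sub>k (of_word a * s))"
  using trivial_mod_term[of s S a 0 w c] assms by (simp add: of_word_zero)

lemma trivial_mod_right:
  assumes "s \<in> S" and "lead s + b \<prec> w"
  shows "trivial_mod S w (c \<cdot>\<^sub>k (s * of_word b))"
  using trivial_mod_term[of s S 0 b w c] assms by (simp add: of_word_zero)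

text \<open>Two finite sums are joined by letting the second one be indexed from the end of the first.\<close>

lemma trivial_mod_add:
  assumes "trivial_mod S w f" and "trivial_mod S w g"
  shows "trivial_mod S w (f + g)"
proof -
  obtain m :: nat and \<alpha> a s b where
    f: "\<forall>i<m. s i \<in> S \<and> a i + lead (s i) + b i \<prec> w"
       "f = (\<Sum>i<m. \<alpha> i \<cdot>\<^sub>k (of_word (a i) * s i * of_word (b i)))"
    using assms(1) unfolding trivial_mod_def by blast
  obtain n :: nat and \<alpha>' a' s' b' where
    g: "\<forall>i<n. s' i \<in> S \<and> a' i + lead (s' i) + b' i \<prec> w"
       "g = (\<Sum>i<n. \<alpha>' i \<cdot>\<^sub>k (of_word (a' i) * s' i * of_word (b' i)))"
    using assms(2) unfolding trivial_mod_def by blast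
  define A where "A i = (if i < m then a i else a' (i - m))" for i
  define B where "B i = (if i < m then b i else b' (i - m))" for i
  define C where "C i = (if i < m then \<alpha> i else \<alpha>' (i - m))" for i
  define T where "T i = (if i < m then s i else s' (i - m))" for i
  let ?t = "\<lambda>i. C i \<cdot>\<^sub>k (of_word (A i) * T i * of_word (B i))"
  have "sum ?t {..<m + n} = sum ?t {..<m} + (\<Sum>i<n. ?t (m + i))"
    by (induction n) (simp_all add: add.assoc)
  moreover have "sum ?t {..<m} = f"
    unfolding f(2) by (rule sum.cong) (simp_all add: A_def B_def C_def T_def)
  moreover have "(\<Sum>i<n. ?t (m + i)) = g"
    unfolding g(2) by (simp add: A_def B_def C_def T_def)
  ultimately have "f + g = sum ?t {..<m + n}" by simp
  moreover have "\<forall>i<m + n. T i \<in> S \<and> A i + lead (T i) + B i \<prec> w"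
    using f(1) g(1) by (auto simp: A_def B_def T_def)
  ultimately show ?thesis
    unfolding trivial_mod_def
    by (intro exI[of _ "m + n"] exI[of _ C] exI[of _ A] exI[of _ T] exI[of _ B] conjI)
qed

lemmas trivial_mod_intros = trivial_mod_add trivial_mod_left trivial_mod_right

section \<open>Overlaps of words of length two\<close>

text \<open>The bound on the length says that the two factors really overlap: one common letter leaves
  a word of length three, two common letters force the words to coincide.\<close>

lemma overlap_two_letters:
  assumes "FWord [u, v] + a = b + FWord [u', v']"
    and "fword_length (FWord [u, v] + a) < 4"
  shows "(a = 0 \<and> b = 0 \<and> u = u' \<and> v = v') \<or> (a = FWord [v'] \<and> b = FWord [u] \<and> v = u')"
proof -
  obtain as bs where ab: "a = FWord as" "b = FWord bs"
    by (cases a; cases b) blast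
  have eq: "u # v # as = bs @ [u', v']"
    using assms(1) by (simp add: ab plus_fword_def)
  have len: "length as < 2"
    using assms(2) by (simp add: ab plus_fword_def fword_length_def)
  from len consider "as = []" | z where "as = [z]"
    by (cases as) auto
  then show ?thesis
  proof cases
    case 1
    then have "length bs = 0" using arg_cong[OF eq, of length] by simp
    then show ?thesis using eq 1 by (simp add: ab zero_fword_def)
  next
    case (2 z)
    then have "length bs = 1" using arg_cong[OF eq, of length] by simp
    then obtain z' where "bs = [z']" by (cases bs) auto
    then show ?thesis using eq 2 by (simp add: ab)
  qed
qed

lemma inclusion_two_letters:
  assumes "FWord [u, v] = a + FWord [u', v'] + b"
  shows "a = 0 \<and> b = 0 \<and> u = u' \<and> v = v'"
proof -
  obtain as bs where ab: "a = FWord as" "b = FWord bs"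
    by (cases a; cases b) blast
  have eq: "[u, v] = as @ [u', v'] @ bs"
    using assms by (simp add: ab plus_fword_def)
  have "length as = 0" "length bs = 0"
    using arg_cong[OF eq, of length] by simp_all
  then show ?thesis using eq by (simp add: ab zero_fword_def)
qed

section \<open>The basis\<close>

definition rel_x2x1 :: "(gen, 'k::field) ncpoly" where
  "rel_x2x1 = x\<^sub>2 * x\<^sub>1 - x\<^sub>1 * x\<^sub>2"
definition rel_y2y1 :: "'k::field \<Rightarrow> (gen, 'k) ncpoly" where
  "rel_y2y1 p = y\<^sub>2 * y\<^sub>1 - p \<cdot>\<^sub>k (y\<^sub>1 * y\<^sub>2)"
definition rel_x1y1 :: "'k::field \<Rightarrow> (gen, 'k) ncpoly" where
  "rel_x1y1 p = x\<^sub>1 * y\<^sub>1 - (1/p) \<cdot>\<^sub>k (y\<^sub>1 * x\<^sub>1)"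
definition rel_x1y2 :: "'k::field \<Rightarrow> (gen, 'k) ncpoly" where
  "rel_x1y2 p = x\<^sub>1 * y\<^sub>2 - (1/p) \<cdot>\<^sub>k (y\<^sub>2 * x\<^sub>1)"
definition rel_x2y1 :: "'k::field \<Rightarrow> (gen, 'k) ncpoly" where
  "rel_x2y1 p =
    x\<^sub>2 * y\<^sub>1 - (1/p^2) \<cdot>\<^sub>k (y\<^sub>1 * x\<^sub>2) + (1/p^2) \<cdot>\<^sub>k (y\<^sub>1 * x\<^sub>1) + (1/p^3) \<cdot>\<^sub>k (y\<^sub>2 * x\<^sub>1)"
definition rel_x2y2 :: "'k::field \<Rightarrow> 'k \<Rightarrow> (gen, 'k) ncpoly" where
  "rel_x2y2 p \<alpha> = x\<^sub>2 * y\<^sub>2 + (\<alpha>/p) \<cdot>\<^sub>k (y\<^sub>1 * x\<^sub>1) - (1/p) \<cdot>\<^sub>k (y\<^sub>2 * x\<^sub>1) - y\<^sub>2 * x\<^sub>2"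

lemmas rel_defs = rel_x2x1_def rel_y2y1_def rel_x1y1_def rel_x1y2_def rel_x2y1_def rel_x2y2_def

lemma G_basis_eq:
  "G_basis p \<alpha> = {rel_x2x1, rel_y2y1 p, rel_x1y1 p, rel_x1y2 p, rel_x2y1 p, rel_x2y2 p \<alpha>}"
  by (simp add: G_basis_def rel_defs)

lemmas gen_defs = y\<^sub>1_def y\<^sub>2_def x\<^sub>1_def x\<^sub>2_def

lemmas word_compute = of_word_mult plus_fword_def

lemma deglex_pair: "FWord [a, b] \<prec> FWord [c, d] \<longleftrightarrow> a < c \<or> a = c \<and> b < d"
  by (auto simp: deglex_def lenlex_conv)

lemma deglex_triple:
  "FWord [a, b, c] \<prec> FWord [a', b', c'] \<longleftrightarrow>
    a < a' \<or> a = a' \<and> (b < b' \<or> b = b' \<and> c < c')"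
  by (auto simp: deglex_def lenlex_conv)

text \<open>Each polynomial is written as a word minus a tail of smaller words, from which the leading
  word and its coefficient are read off together. The tails \<open>g\<close> are also the right-hand
  sides of the rewriting rules behind the compositions.\<close>

lemma rel_monic_lead:
  fixes p \<alpha> :: "'k::field"
  shows "is_monic (rel_x2x1 :: (gen, 'k) ncpoly) \<and> lead (rel_x2x1 :: (gen, 'k) ncpoly) = FWord [X2, X1]"
    and "is_monic (rel_y2y1 p) \<and> lead (rel_y2y1 p) = FWord [Y2, Y1]"
    and "is_monic (rel_x1y1 p) \<and> lead (rel_x1y1 p) = FWord [X1, Y1]"
    and "is_monic (rel_x1y2 p) \<and> lead (rel_x1y2 p) = FWord [X1, Y2]"
    and "is_monic (rel_x2y1 p) \<and> lead (rel_x2y1 p) = FWord [X2, Y1]"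
    and "is_monic (rel_x2y2 p \<alpha>) \<and> lead (rel_x2y2 p \<alpha>) = FWord [X2, Y2]"
proof -
  show "is_monic (rel_x2x1 :: (gen, 'k) ncpoly) \<and> lead (rel_x2x1 :: (gen, 'k) ncpoly) = FWord [X2, X1]"
    by (rule monic_leadI[where g = "x\<^sub>1 * x\<^sub>2 :: (gen, 'k) ncpoly"])
      (simp_all add: rel_x2x1_def gen_defs word_compute below_intros deglex_pair less_gen_def)
  show "is_monic (rel_y2y1 p) \<and> lead (rel_y2y1 p) = FWord [Y2, Y1]"
    by (rule monic_leadI[where g = "p \<cdot>\<^sub>k (y\<^sub>1 * y\<^sub>2)"])
      (simp_all add: rel_y2y1_def gen_defs word_compute below_intros deglex_pair less_gen_def)
  show "is_monic (rel_x1y1 p) \<and> lead (rel_x1y1 p) = FWord [X1, Y1]"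
    by (rule monic_leadI[where g = "(1/p) \<cdot>\<^sub>k (y\<^sub>1 * x\<^sub>1)"])
      (simp_all add: rel_x1y1_def gen_defs word_compute below_intros deglex_pair less_gen_def)
  show "is_monic (rel_x1y2 p) \<and> lead (rel_x1y2 p) = FWord [X1, Y2]"
    by (rule monic_leadI[where g = "(1/p) \<cdot>\<^sub>k (y\<^sub>2 * x\<^sub>1)"])
      (simp_all add: rel_x1y2_def gen_defs word_compute below_intros deglex_pair less_gen_def)
  show "is_monic (rel_x2y1 p) \<and> lead (rel_x2y1 p) = FWord [X2, Y1]"
    by (rule monic_leadI[where g = "(1/p^2) \<cdot>\<^sub>k (y\<^sub>1 * x\<^sub>2) - (1/p^2) \<cdot>\<^sub>k (y\<^sub>1 * x\<^sub>1) - (1/p^3) \<cdot>\<^sub>k (y\<^sub>2 * x\<^sub>1)"])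
      (simp_all add: rel_x2y1_def gen_defs word_compute below_intros deglex_pair less_gen_def)
  show "is_monic (rel_x2y2 p \<alpha>) \<and> lead (rel_x2y2 p \<alpha>) = FWord [X2, Y2]"
    by (rule monic_leadI[where g = "(1/p) \<cdot>\<^sub>k (y\<^sub>2 * x\<^sub>1) + y\<^sub>2 * x\<^sub>2 - (\<alpha>/p) \<cdot>\<^sub>k (y\<^sub>1 * x\<^sub>1)"])
      (simp_all add: rel_x2y2_def gen_defs word_compute below_intros deglex_pair less_gen_def)
qed

lemmas rel_lead = rel_monic_lead[THEN conjunct2]
lemmas rel_monic = rel_monic_lead[THEN conjunct1]

section \<open>The four essential compositions\<close>

text \<open>In each identity the terms on the right are the successive rewriting steps that bring both
  sides of the overlap to normal form. The identities are linear in the words of length three,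
  so they can be checked coefficient by coefficient. Coefficients \<open>1\<close> and \<open>-1\<close> are written out so
  that every summand has the shape of \<open>trivial_mod_left\<close> or \<open>trivial_mod_right\<close>.\<close>

lemma composition_x2_x1_y1:
  fixes p :: "'k::field"
  assumes "p \<noteq> 0"
  shows "rel_x2x1 * y\<^sub>1 - x\<^sub>2 * rel_x1y1 p =
    (-1) \<cdot>\<^sub>k (x\<^sub>1 * rel_x2y1 p) + (1/p) \<cdot>\<^sub>k (rel_x2y1 p * x\<^sub>1) + (-(1/p^2)) \<cdot>\<^sub>k (rel_x1y1 p * x\<^sub>2)
    + (1/p^2) \<cdot>\<^sub>k (rel_x1y1 p * x\<^sub>1) + (1/p^3) \<cdot>\<^sub>k (rel_x1y2 p * x\<^sub>1) + (1/p^3) \<cdot>\<^sub>k (y\<^sub>1 * rel_x2x1)"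
  unfolding rel_defs expand_products
  by (rule poly_mapping_eqI)
    (simp add: lookup_linear inverse_normal[OF assms] algebra_simps)

lemma composition_x2_x1_y2:
  fixes p \<alpha> :: "'k::field"
  assumes "p \<noteq> 0"
  shows "rel_x2x1 * y\<^sub>2 - x\<^sub>2 * rel_x1y2 p =
    (-1) \<cdot>\<^sub>k (x\<^sub>1 * rel_x2y2 p \<alpha>) + (1/p) \<cdot>\<^sub>k (rel_x2y2 p \<alpha> * x\<^sub>1) + (\<alpha>/p) \<cdot>\<^sub>k (rel_x1y1 p * x\<^sub>1)
    + (-(1/p)) \<cdot>\<^sub>k (rel_x1y2 p * x\<^sub>1) + (-1) \<cdot>\<^sub>k (rel_x1y2 p * x\<^sub>2) + (1/p) \<cdot>\<^sub>k (y\<^sub>2 * rel_x2x1)"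
  unfolding rel_defs expand_products
  by (rule poly_mapping_eqI)
    (simp add: lookup_linear inverse_normal[OF assms] algebra_simps)

lemma composition_x1_y2_y1:
  fixes p :: "'k::field"
  assumes "p \<noteq> 0"
  shows "rel_x1y2 p * y\<^sub>1 - x\<^sub>1 * rel_y2y1 p =
    (-(1/p)) \<cdot>\<^sub>k (y\<^sub>2 * rel_x1y1 p) + p \<cdot>\<^sub>k (rel_x1y1 p * y\<^sub>2)
    + (-(1/p^2)) \<cdot>\<^sub>k (rel_y2y1 p * x\<^sub>1) + 1 \<cdot>\<^sub>k (y\<^sub>1 * rel_x1y2 p)"
  unfolding rel_defs expand_products
  by (rule poly_mapping_eqI)
    (simp add: lookup_linear inverse_normal[OF assms] algebra_simps)

lemma composition_x2_y2_y1:
  fixes p \<alpha> :: "'k::field"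
  assumes "p \<noteq> 0"
  shows "rel_x2y2 p \<alpha> * y\<^sub>1 - x\<^sub>2 * rel_y2y1 p =
    (\<alpha>/p) \<cdot>\<^sub>k (y\<^sub>1 * rel_x1y1 p) + (-(1/p)) \<cdot>\<^sub>k (y\<^sub>2 * rel_x1y1 p) + (-1) \<cdot>\<^sub>k (y\<^sub>2 * rel_x2y1 p)
    + p \<cdot>\<^sub>k (rel_x2y1 p * y\<^sub>2) + (-(1/p^2)) \<cdot>\<^sub>k (rel_y2y1 p * x\<^sub>2) + (1/p) \<cdot>\<^sub>k (y\<^sub>1 * rel_x2y2 p \<alpha>)
    + (-(1/p)) \<cdot>\<^sub>k (y\<^sub>1 * rel_x1y2 p) + (-(1/p^2)) \<cdot>\<^sub>k (y\<^sub>2 * rel_x1y2 p)"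
  unfolding rel_defs expand_products
  by (rule poly_mapping_eqI)
    (simp add: lookup_linear inverse_normal[OF assms] algebra_simps)

lemma essential_compositions_trivial:
  fixes p \<alpha> :: "'k::field"
  assumes "p \<noteq> 0"
  shows "trivial_mod (G_basis p \<alpha>) (FWord [X2, X1, Y1]) (rel_x2x1 * y\<^sub>1 - x\<^sub>2 * rel_x1y1 p)"
    and "trivial_mod (G_basis p \<alpha>) (FWord [X2, X1, Y2]) (rel_x2x1 * y\<^sub>2 - x\<^sub>2 * rel_x1y2 p)"
    and "trivial_mod (G_basis p \<alpha>) (FWord [X1, Y2, Y1]) (rel_x1y2 p * y\<^sub>1 - x\<^sub>1 * rel_y2y1 p)"
    and "trivial_mod (G_basis p \<alpha>) (FWord [X2, Y2, Y1]) (rel_x2y2 p \<alpha> * y\<^sub>1 - x\<^sub>2 * rel_y2y1 p)"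
  unfolding composition_x2_x1_y1[OF assms] composition_x2_x1_y2[OF assms, of \<alpha>]
    composition_x1_y2_y1[OF assms] composition_x2_y2_y1[OF assms]
  unfolding gen_defs
  by goal_cases (intro trivial_mod_intros;
      simp add: G_basis_eq rel_lead plus_fword_def deglex_triple less_gen_def)+

lemma G_basis_compositions_trivial:
  fixes p \<alpha> :: "'k::field"
  assumes p: "p \<noteq> 0" and f: "f \<in> G_basis p \<alpha>" and g: "g \<in> G_basis p \<alpha>"
    and h: "is_composition f g w h"
  shows "trivial_mod (G_basis p \<alpha>) w h"
proof -
  have two: "\<exists>u v. lead s = FWord [u, v]" if "s \<in> G_basis p \<alpha>" for s
    using that by (auto simp: G_basis_eq rel_lead)
  have lead_inj: "s = t" if "s \<in> G_basis p \<alpha>" "t \<in> G_basis p \<alpha>" "lead s = lead t" for s t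
    using that by (auto simp: G_basis_eq rel_lead)
  obtain u v where uv: "lead f = FWord [u, v]" using two[OF f] by blast
  obtain u' v' where uv': "lead g = FWord [u', v']" using two[OF g] by blast
  from h consider "f = g" "h = 0"
    | "v = u'" "w = FWord [u, v, v']" "h = f * of_word (FWord [v']) - of_word (FWord [u]) * g"
  proof (unfold is_composition_def, elim disjE)
    assume "is_intersection_composition f g w h"
    then obtain a b where ab: "w = lead f + a" "w = b + lead g"
      "fword_length (lead f) + fword_length (lead g) > fword_length w"
      "h = f * of_word a - of_word b * g"
      unfolding is_intersection_composition_def by blast
    have "FWord [u, v] + a = b + FWord [u', v']" "fword_length (FWord [u, v] + a) < 4"
      using ab(1-3) by (simp_all add: uv uv' fword_length_def)
    from overlap_two_letters[OF this] show thesis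
    proof (elim disjE conjE)
      assume "a = 0" "b = 0" "u = u'" "v = v'"
      moreover from this have "f = g" using lead_inj[OF f g] uv uv' by simp
      ultimately show thesis using ab(4) that(1) by (simp add: of_word_zero)
    next
      assume "a = FWord [v']" "b = FWord [u]" "v = u'"
      then show thesis using ab(1,4) that(2) by (simp add: uv plus_fword_def)
    qed
  next
    assume "is_inclusion_composition f g w h"
    then obtain a b where ab: "lead f = a + lead g + b" "h = f - of_word a * g * of_word b"
      unfolding is_inclusion_composition_def by blast
    then have eq: "a = 0 \<and> b = 0 \<and> u = u' \<and> v = v'"
      using inclusion_two_letters[of u v a u' v' b] by (simp add: uv uv')
    then have "f = g" using lead_inj[OF f g] uv uv' by simp
    then show thesis using ab(2) eq that(1) by (simp add: of_word_zero)
  qed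
  then show ?thesis
  proof cases
    case 1
    then show ?thesis by (simp add: trivial_mod_zero)
  next
    case 2
    show ?thesis
      using f g uv uv' 2 essential_compositions_trivial[OF p, of \<alpha>]
      by (auto simp: G_basis_eq rel_lead gen_defs)
  qed
qed

section \<open>The ideal of relations\<close>

lemma ideal_gen_ideal: "ideal (ideal_gen S) (free_algebra :: ('k::field, ('x, 'k) ncpoly) module)"
  unfolding ideal_gen_def
  by (rule ring.genideal_ideal[OF ring_free_algebra]) (simp add: free_algebra_def)

lemma ideal_gen_superset: "S \<subseteq> ideal_gen S"
  unfolding ideal_gen_def
  by (rule ring.genideal_self[OF ring_free_algebra]) (simp add: free_algebra_def)

lemma ideal_gen_least:
  assumes "S \<subseteq> ideal_gen T"
  shows "ideal_gen S \<subseteq> ideal_gen T"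
  using ring.genideal_minimal[OF ring_free_algebra ideal_gen_ideal assms]
  by (simp add: ideal_gen_def)

lemma ideal_gen_add: "f \<in> ideal_gen S \<Longrightarrow> g \<in> ideal_gen S \<Longrightarrow> f + g \<in> ideal_gen S"
  using additive_subgroup.a_closed[OF ideal.axioms(1)[OF ideal_gen_ideal]]
  by (fastforce simp: free_algebra_def)

lemma ideal_gen_scal: "f \<in> ideal_gen S \<Longrightarrow> c \<cdot>\<^sub>k f \<in> ideal_gen S"
  using ideal.I_l_closed[OF ideal_gen_ideal, of f S "Poly_Mapping.single 0 c"]
  by (simp add: free_algebra_def scal_eq_mult)

lemmas ideal_gen_intros = ideal_gen_add ideal_gen_scal

lemma ideal_gen_G_basis:
  fixes p \<alpha> :: "'k::field"
  assumes p: "p \<noteq> 0"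
  shows "ideal_gen (G_basis p \<alpha>) = ideal_gen (G_relations p \<alpha>)"
proof -
  define R3 :: "(gen, 'k) ncpoly" where "R3 = y\<^sub>1 * x\<^sub>1 - p \<cdot>\<^sub>k (x\<^sub>1 * y\<^sub>1)"
  define R4 :: "(gen, 'k) ncpoly" where "R4 = y\<^sub>2 * x\<^sub>1 - p \<cdot>\<^sub>k (x\<^sub>1 * y\<^sub>2)"
  define R5 :: "(gen, 'k) ncpoly" where
    "R5 = y\<^sub>1 * x\<^sub>2 - (p \<cdot>\<^sub>k (x\<^sub>1 * y\<^sub>1) + p^2 \<cdot>\<^sub>k (x\<^sub>2 * y\<^sub>1) + x\<^sub>1 * y\<^sub>2)"
  define R6 :: "(gen, 'k) ncpoly" where
    "R6 = y\<^sub>2 * x\<^sub>2 - (\<alpha> \<cdot>\<^sub>k (x\<^sub>1 * y\<^sub>1) - x\<^sub>1 * y\<^sub>2 + x\<^sub>2 * y\<^sub>2)"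
  note R_defs = R3_def R4_def R5_def R6_def
  have relations: "G_relations p \<alpha> = {rel_x2x1, rel_y2y1 p, R3, R4, R5, R6}"
    by (simp add: G_relations_def rel_defs R_defs)
  have basis_from_relations:
    "rel_x1y1 p = (-(1/p)) \<cdot>\<^sub>k R3"
    "rel_x1y2 p = (-(1/p)) \<cdot>\<^sub>k R4"
    "rel_x2y1 p = (-(1/p^2)) \<cdot>\<^sub>k R5 + (1/p^2) \<cdot>\<^sub>k R3 + (1/p^3) \<cdot>\<^sub>k R4"
    "rel_x2y2 p \<alpha> = (-1) \<cdot>\<^sub>k R6 + (\<alpha>/p) \<cdot>\<^sub>k R3 + (-(1/p)) \<cdot>\<^sub>k R4"
    by (rule poly_mapping_eqI, simp add: rel_defs R_defs lookup_linear inverse_normal[OF p] algebra_simps)+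
  have relations_from_basis:
    "R3 = (-p) \<cdot>\<^sub>k rel_x1y1 p"
    "R4 = (-p) \<cdot>\<^sub>k rel_x1y2 p"
    "R5 = (-(p^2)) \<cdot>\<^sub>k rel_x2y1 p + (-p) \<cdot>\<^sub>k rel_x1y1 p + (-1) \<cdot>\<^sub>k rel_x1y2 p"
    "R6 = (-1) \<cdot>\<^sub>k rel_x2y2 p \<alpha> + (-\<alpha>) \<cdot>\<^sub>k rel_x1y1 p + 1 \<cdot>\<^sub>k rel_x1y2 p"
    by (rule poly_mapping_eqI, simp add: rel_defs R_defs lookup_linear inverse_normal[OF p] algebra_simps)+
  have "R \<in> ideal_gen (G_relations p \<alpha>)" if "R \<in> {rel_x2x1, rel_y2y1 p, R3, R4, R5, R6}" for R
    using that ideal_gen_superset[of "G_relations p \<alpha>"] unfolding relations by blast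
  then have "G_basis p \<alpha> \<subseteq> ideal_gen (G_relations p \<alpha>)"
    unfolding G_basis_eq basis_from_relations by (auto intro!: ideal_gen_intros)
  moreover have "r \<in> ideal_gen (G_basis p \<alpha>)"
    if "r \<in> {rel_x2x1, rel_y2y1 p, rel_x1y1 p, rel_x1y2 p, rel_x2y1 p, rel_x2y2 p \<alpha>}" for r
    using that ideal_gen_superset[of "G_basis p \<alpha>"] unfolding G_basis_eq by blast
  then have "G_relations p \<alpha> \<subseteq> ideal_gen (G_basis p \<alpha>)"
    unfolding relations relations_from_basis by (auto intro!: ideal_gen_intros)
  ultimately show ?thesis
    by (intro equalityI ideal_gen_least)
qed

theorem mainTheorem5:
  fixes p \<alpha> :: "'k::field"
  assumes "p \<noteq> 0" and "p \<noteq> 1" and "p \<noteq> -1" and "\<alpha> \<noteq> 0"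
  shows "groebner_shirshov_basis (G_basis p \<alpha>)
    \<and> ideal_gen (G_basis p \<alpha>) = ideal_gen (G_relations p \<alpha>)
    \<and> G_algebra p \<alpha> = quotient_algebra free_algebra (ideal_gen (G_basis p \<alpha>))"
proof (intro conjI)
  have "\<forall>f \<in> G_basis p \<alpha>. is_monic f"
    by (simp add: G_basis_eq rel_monic)
  then show "groebner_shirshov_basis (G_basis p \<alpha>)"
    unfolding groebner_shirshov_basis_def
    using G_basis_compositions_trivial[OF assms(1)] by (auto simp: G_basis_eq)
  show ideals: "ideal_gen (G_basis p \<alpha>) = ideal_gen (G_relations p \<alpha>)"
    by (rule ideal_gen_G_basis[OF assms(1)])
  then show "G_algebra p \<alpha> = quotient_algebra free_algebra (ideal_gen (G_basis p \<alpha>))"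
    by (simp add: G_algebra_def presented_algebra_def)
qed

end
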